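(* For any $m$, no $\equiv_2$-optimal finite $m$-coloured string realizes the same $1$-character more than once. That is, if $(A,<,F)$ is a $\equiv_2$-optimal finite $m$-coloured linear order, then any two distinct points of $A$ have different $1$-characters (the colour of the point being part of the $1$-character).
   Context: An $m$-coloured linear order (or string, when finite) is a triple $(A,<,F)$ where $(A,<)$ is a linear order and $F$ is a map from $A$ onto a set of $m$ colours. In the $n$-move Ehrenfeucht-Fraïssé game on coloured linear orders $A$ and $B$, players I and II move alternately, I first; on each move I picks an element of either structure and II responds with an element of the other structure. After $n$ moves elements $a_1,\dots,a_n\in A$ and $b_1,\dots,b_n\in B$ have been chosen, and II wins if $a_i\mapsto b_i$ is an order- and colour-isomorphism. $A\equiv_n B$ means that II has a winning strategy. A finite coloured linear order is $\equiv_n$-optimal if no coloured linear order of smaller length is $n$-equivalent to it. For $a\in A$ let $A^{<a}=\{x\in A:x<a\}$ and $A^{>a}=\{x\in A:x>a\}$ with the induced order and colouring. The $n$-character of $a$ in $A$ is the triple consisting of the $\equiv_n$-class of $A^{<a}$, the $\equiv_n$-class of $A^{>a}$, and the colour $F(a)$; two points have the same $n$-character iff all three components agree. *)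

theory Defs
  imports Main
begin

text \<open>
  A coloured linear order (A,<,F). The strict order is a set of pairs on A; the values of F
  outside A are irrelevant, since only colours of points of A are ever inspected.
\<close>

record ('a, 'c) col_order =
  points :: "'a set"
  less_rel :: "'a rel"
  colour :: "'a \<Rightarrow> 'c"

definition coloured_linear_order :: "('a, 'c) col_order \<Rightarrow> bool" where
  "coloured_linear_order A \<longleftrightarrow>
     less_rel A \<subseteq> points A \<times> points A \<and> strict_linear_order_on (points A) (less_rel A)"

text \<open>The colouring is onto a set of exactly \<open>m\<close> colours.\<close>

definition m_coloured_linear_order :: "nat \<Rightarrow> ('a, 'c) col_order \<Rightarrow> bool" where
  "m_coloured_linear_order m A \<longleftrightarrow>
     coloured_linear_order A \<and> finite (colour A ` points A) \<and> card (colour A ` points A) = m"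

definition induced :: "('a, 'c) col_order \<Rightarrow> 'a set \<Rightarrow> ('a, 'c) col_order" where
  "induced A X =
     \<lparr> points = points A \<inter> X,
       less_rel = less_rel A \<inter> ((points A \<inter> X) \<times> (points A \<inter> X)),
       colour = colour A \<rparr>"

definition below :: "('a, 'c) col_order \<Rightarrow> 'a \<Rightarrow> ('a, 'c) col_order" where
  "below A a = induced A {x. (x, a) \<in> less_rel A}"

definition above :: "('a, 'c) col_order \<Rightarrow> 'a \<Rightarrow> ('a, 'c) col_order" where
  "above A a = induced A {x. (a, x) \<in> less_rel A}"

text \<open>
  The Ehrenfeucht-Fraisse game. A move of player I is \<open>Inl a\<close> (a point of the first structure)
  or \<open>Inr b\<close> (a point of the second). A strategy for player II is a pair of functions
  \<open>(s, t)\<close>: given the list of the earlier moves of player I, \<open>s\<close> answers a current move \<open>Inl a\<close>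
  and \<open>t\<close> answers a current move \<open>Inr b\<close>. Player II's own earlier answers need not be recorded,
  as the strategy determines them. In \<open>play A B (s, t) ms ps\<close>, \<open>ms\<close> lists the moves of player I and
  \<open>ps\<close> the resulting pairs \<open>(a\<^sub>i, b\<^sub>i)\<close>, when player II follows \<open>(s, t)\<close>.
\<close>

type_synonym ('a, 'b) strategy =
  "(('a + 'b) list \<Rightarrow> 'a \<Rightarrow> 'b) \<times> (('a + 'b) list \<Rightarrow> 'b \<Rightarrow> 'a)"

inductive play ::
  "('a, 'c) col_order \<Rightarrow> ('b, 'c) col_order \<Rightarrow> ('a, 'b) strategy \<Rightarrow>
     ('a + 'b) list \<Rightarrow> ('a \<times> 'b) list \<Rightarrow> bool"
  for A B \<sigma> where
    start: "play A B \<sigma> [] []"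
  | pick_left: "play A B \<sigma> ms ps \<Longrightarrow> a \<in> points A \<Longrightarrow>
      play A B \<sigma> (ms @ [Inl a]) (ps @ [(a, fst \<sigma> ms a)])"
  | pick_right: "play A B \<sigma> ms ps \<Longrightarrow> b \<in> points B \<Longrightarrow>
      play A B \<sigma> (ms @ [Inr b]) (ps @ [(snd \<sigma> ms b, b)])"

definition partial_iso ::
  "('a, 'c) col_order \<Rightarrow> ('b, 'c) col_order \<Rightarrow> ('a \<times> 'b) list \<Rightarrow> bool" where
  "partial_iso A B ps \<longleftrightarrow>
     (\<forall>(a, b) \<in> set ps. colour A a = colour B b) \<and>
     (\<forall>(a, b) \<in> set ps. \<forall>(a', b') \<in> set ps.
        (a = a' \<longleftrightarrow> b = b') \<and>
        ((a, a') \<in> less_rel A \<longleftrightarrow> (b, b') \<in> less_rel B))"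

text \<open>
  The condition \<open>set ps \<subseteq> points A \<times> points B\<close> says that the answers of player II are legal; in
  particular player II loses when a point has to be picked from an empty structure.
\<close>

definition winning_strategy ::
  "nat \<Rightarrow> ('a, 'c) col_order \<Rightarrow> ('b, 'c) col_order \<Rightarrow> ('a, 'b) strategy \<Rightarrow> bool" where
  "winning_strategy n A B \<sigma> \<longleftrightarrow>
     (\<forall>ms ps. play A B \<sigma> ms ps \<and> length ms = n \<longrightarrow>
        set ps \<subseteq> points A \<times> points B \<and> partial_iso A B ps)"

definition ef_equiv :: "nat \<Rightarrow> ('a, 'c) col_order \<Rightarrow> ('b, 'c) col_order \<Rightarrow> bool" where
  "ef_equiv n A B \<longleftrightarrow> (\<exists>\<sigma>. winning_strategy n A B \<sigma>)"

text \<open>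
  The competitors \<open>B\<close> may be taken on the same type of points as \<open>A\<close>: any coloured linear order
  with fewer points than \<open>A\<close> has an isomorphic copy whose points lie in \<open>points A\<close>, with an
  order unrelated to that of \<open>A\<close>.
\<close>

definition optimal :: "nat \<Rightarrow> ('a, 'c) col_order \<Rightarrow> bool" where
  "optimal n A \<longleftrightarrow>
     coloured_linear_order A \<and> finite (points A) \<and>
     \<not> (\<exists>B :: ('a, 'c) col_order. coloured_linear_order B \<and> finite (points B) \<and>
           card (points B) < card (points A) \<and> ef_equiv n A B)"

text \<open>
  The \<open>\<equiv>\<^sub>n\<close>-class of \<open>A\<close> among coloured linear orders on the same type of points. All the orders
  whose classes are compared below are suborders of a single one, hence on one type.
\<close>

definition ef_class :: "nat \<Rightarrow> ('a, 'c) col_order \<Rightarrow> ('a, 'c) col_order set" where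
  "ef_class n A = {B. coloured_linear_order B \<and> ef_equiv n A B}"

definition "character" ::
  "nat \<Rightarrow> ('a, 'c) col_order \<Rightarrow> 'a \<Rightarrow> ('a, 'c) col_order set \<times> ('a, 'c) col_order set \<times> 'c"
where
  "character n A a = (ef_class n (below A a), ef_class n (above A a), colour A a)"

end

theory Submission
  imports Defs
begin

text \<open>
  One round of the game sees only which colours occur, so the \<open>1\<close>-character of a point is its
  own colour together with the sets of colours occurring below and above it; and two orders are
  \<open>2\<close>-equivalent as soon as they realize the same such triples (\<open>ef_equiv_2I\<close>).

  Suppose \<open>a < b\<close> have the same \<open>1\<close>-character in \<open>A\<close>, with common colour \<open>c\<close>. As \<open>b\<close> lies above
  \<open>a\<close>, the colour \<open>c\<close> occurs above \<open>a\<close>, hence also above \<open>b\<close>, say at \<open>e\<close>. So \<open>a < b < e\<close> all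
  have colour \<open>c\<close>. Now delete \<open>b\<close>. A point below \<open>b\<close> still sees \<open>c\<close> above it, at \<open>e\<close>, and a
  point above \<open>b\<close> still sees \<open>c\<close> below it, at \<open>a\<close>, so each remaining point keeps its triple. The
  triple of \<open>b\<close> is still realized, by \<open>a\<close>. Thus the shorter order is \<open>2\<close>-equivalent to \<open>A\<close>, and
  \<open>A\<close> is not optimal
  (\<open>equal_profile_not_optimal\<close>).
\<close>

section \<open>One round: colour profiles\<close>

definition colour_profile :: "('a, 'c) col_order \<Rightarrow> 'a \<Rightarrow> 'c set \<times> 'c set \<times> 'c" where
  "colour_profile A x =
     (colour A ` {y \<in> points A. (y, x) \<in> less_rel A},
      colour A ` {y \<in> points A. (x, y) \<in> less_rel A},
      colour A x)"

lemma ef_equiv_1_imp_same_colours: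
  assumes "ef_equiv 1 A B"
  shows "colour A ` points A = colour B ` points B"
proof -
  obtain \<sigma> where w: "winning_strategy 1 A B \<sigma>"
    using assms by (auto simp: ef_equiv_def)
  have l: "fst \<sigma> [] x \<in> points B \<and> colour A x = colour B (fst \<sigma> [] x)" if "x \<in> points A" for x
    using w play.pick_left[OF play.start[of A B \<sigma>] that]
    by (fastforce simp: winning_strategy_def partial_iso_def)
  have r: "snd \<sigma> [] y \<in> points A \<and> colour A (snd \<sigma> [] y) = colour B y" if "y \<in> points B" for y
    using w play.pick_right[OF play.start[of A B \<sigma>] that]
    by (fastforce simp: winning_strategy_def partial_iso_def)
  show ?thesis
    using l r by (auto simp: image_iff) metis+
qed

lemma ef_equiv_refl: "ef_equiv n A A"
proof -
  let ?\<sigma> = "(\<lambda>_ x. x, \<lambda>_ x. x)"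
  have diag: "set ps \<subseteq> Id_on (points A)" if "play A A ?\<sigma> ms ps" for ms ps
    using that by (induction rule: play.induct) auto
  have "winning_strategy n A A ?\<sigma>"
    unfolding winning_strategy_def partial_iso_def by (auto dest!: diag)
  then show ?thesis by (auto simp: ef_equiv_def)
qed

lemma coloured_linear_order_induced:
  assumes "coloured_linear_order A"
  shows "coloured_linear_order (induced A X)"
  using assms
  unfolding coloured_linear_order_def induced_def strict_linear_order_on_def
    trans_on_def irrefl_on_def total_on_def
  by (simp, blast)

text \<open>
  Since \<open>\<equiv>\<^sub>n\<close> is reflexive, \<open>B\<close> lies in its own class, hence in that of \<open>A\<close>.
\<close>

lemma ef_class_eq_imp_ef_equiv:
  assumes "coloured_linear_order B" and "ef_class n A = ef_class n B"
  shows "ef_equiv n A B"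
  using assms ef_equiv_refl[of n B] by (auto simp: ef_class_def)

lemma character_1_eq_imp_colour_profile_eq:
  assumes A: "coloured_linear_order A" and eq: "character 1 A a = character 1 A b"
  shows "colour_profile A a = colour_profile A b"
proof -
  have pts: "points (below A x) = {y \<in> points A. (y, x) \<in> less_rel A}"
    "points (above A x) = {y \<in> points A. (x, y) \<in> less_rel A}"
    "colour (below A x) = colour A" "colour (above A x) = colour A" for x
    by (auto simp: below_def above_def induced_def)
  have "ef_equiv 1 (below A a) (below A b)"
    using eq coloured_linear_order_induced[OF A]
    by (intro ef_class_eq_imp_ef_equiv) (simp_all add: character_def below_def)
  moreover have "ef_equiv 1 (above A a) (above A b)"
    using eq coloured_linear_order_induced[OF A]
    by (intro ef_class_eq_imp_ef_equiv) (simp_all add: character_def above_def)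
  ultimately show ?thesis
    using eq ef_equiv_1_imp_same_colours[of "below A a" "below A b"]
      ef_equiv_1_imp_same_colours[of "above A a" "above A b"]
    by (simp add: character_def colour_profile_def pts)
qed

section \<open>Two rounds\<close>

lemma partial_iso_pair_swap:
  "partial_iso A B [(x, y), (x', y')] \<longleftrightarrow> partial_iso B A [(y, x), (y', x')]"
  by (auto simp: partial_iso_def)

text \<open>
  A second move equal to, below or above the first point is answered equal to, below or above
  the first answer; equality of profiles provides an answer of the right colour there.
\<close>

lemma second_answer_exists:
  assumes A: "coloured_linear_order A" and B: "coloured_linear_order B"
    and x: "x \<in> points A" and y: "y \<in> points B" and x': "x' \<in> points A"
    and eq: "colour_profile A x = colour_profile B y"
  shows "\<exists>y' \<in> points B. partial_iso A B [(x, y), (x', y')]"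
proof -
  have irr: "(u, u) \<notin> less_rel A" "(v, v) \<notin> less_rel B" for u v
    using A B unfolding coloured_linear_order_def strict_linear_order_on_def irrefl_on_def
    by blast+
  have asym: "(u, v) \<in> less_rel A \<Longrightarrow> (v, u) \<notin> less_rel A"
    "(u', v') \<in> less_rel B \<Longrightarrow> (v', u') \<notin> less_rel B" for u v u' v'
    using A B irr unfolding coloured_linear_order_def strict_linear_order_on_def
    by (meson transD)+
  have c: "colour A x = colour B y" using eq by (simp add: colour_profile_def)
  consider "x' = x" | "(x', x) \<in> less_rel A" | "(x, x') \<in> less_rel A"
    using A x x' unfolding coloured_linear_order_def strict_linear_order_on_def total_on_def
    by blast
  then show ?thesis
  proof cases
    case 1
    then show ?thesis using c irr y by (auto simp: partial_iso_def)
  next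
    case 2
    then have "colour A x' \<in> colour B ` {z \<in> points B. (z, y) \<in> less_rel B}"
      using eq x' by (auto simp: colour_profile_def)
    then obtain y' where "y' \<in> points B" "(y', y) \<in> less_rel B" "colour A x' = colour B y'"
      by auto
    then show ?thesis
      using 2 c irr asym by (intro bexI[of _ y']) (auto simp: partial_iso_def)
  next
    case 3
    then have "colour A x' \<in> colour B ` {z \<in> points B. (y, z) \<in> less_rel B}"
      using eq x' by (auto simp: colour_profile_def)
    then obtain y' where "y' \<in> points B" "(y, y') \<in> less_rel B" "colour A x' = colour B y'"
      by auto
    then show ?thesis
      using 3 c irr asym by (intro bexI[of _ y']) (auto simp: partial_iso_def)
  qed
qed

lemma play_length_2_cases:
  assumes "play A B \<sigma> ms ps" and "length ms = 2"
  obtains m p where "play A B \<sigma> [m] [p]"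
    and "(\<exists>x \<in> points A. ps = [p, (x, fst \<sigma> [m] x)]) \<or> (\<exists>y \<in> points B. ps = [p, (snd \<sigma> [m] y, y)])"
proof -
  have len: "length ms = length ps" if "play A B \<sigma> ms ps" for ms ps
    using that by (induction rule: play.induct) auto
  from assms(1) show ?thesis
  proof cases
    case start
    then show ?thesis using assms(2) by simp
  next
    case (pick_left ms' ps' x)
    moreover from this obtain m p where "ms' = [m]" "ps' = [p]"
      using assms(2) len[of ms' ps'] by (auto simp: length_Suc_conv)
    ultimately show ?thesis using that by auto
  next
    case (pick_right ms' ps' y)
    moreover from this obtain m p where "ms' = [m]" "ps' = [p]"
      using assms(2) len[of ms' ps'] by (auto simp: length_Suc_conv)
    ultimately show ?thesis using that by auto
  qed
qed

lemma play_length_1_cases: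
  assumes "play A B \<sigma> [m] [p]"
  shows "(\<exists>x \<in> points A. m = Inl x \<and> p = (x, fst \<sigma> [] x)) \<or>
    (\<exists>y \<in> points B. m = Inr y \<and> p = (snd \<sigma> [] y, y))"
proof -
  have empty: "ps = []" if "play A B \<sigma> [] ps" for ps
    using that by cases auto
  from assms show ?thesis by cases (auto dest: empty)
qed

text \<open>
  Player II opens with a point of the same profile. This leaves the pair of points in which the
  second move can always be answered, whichever side it is played on.
\<close>

lemma ef_equiv_2I:
  assumes A: "coloured_linear_order A" and B: "coloured_linear_order B"
    and profiles: "colour_profile A ` points A = colour_profile B ` points B"
  shows "ef_equiv 2 A B"
proof -
  have "\<forall>x \<in> points A. \<exists>y. y \<in> points B \<and> colour_profile A x = colour_profile B y"
  proof
    fix x assume "x \<in> points A"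
    then have "colour_profile A x \<in> colour_profile B ` points B"
      unfolding profiles[symmetric] by (rule imageI)
    then show "\<exists>y. y \<in> points B \<and> colour_profile A x = colour_profile B y"
      unfolding image_iff by blast
  qed
  from bchoice[OF this] obtain f
    where f: "\<forall>x \<in> points A. f x \<in> points B \<and> colour_profile A x = colour_profile B (f x)"
    by blast
  have "\<forall>y \<in> points B. \<exists>x. x \<in> points A \<and> colour_profile A x = colour_profile B y"
  proof
    fix y assume "y \<in> points B"
    then have "colour_profile B y \<in> colour_profile A ` points A"
      unfolding profiles by (rule imageI)
    then show "\<exists>x. x \<in> points A \<and> colour_profile A x = colour_profile B y"
      unfolding image_iff by metis
  qed
  from bchoice[OF this] obtain g
    where g: "\<forall>y \<in> points B. g y \<in> points A \<and> colour_profile A (g y) = colour_profile B y"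
    by blast
  \<comment> \<open>The opening move determines the first pair, so the second answer may depend on that pair.\<close>
  define first where "first m = (case m of Inl x \<Rightarrow> (x, f x) | Inr y \<Rightarrow> (g y, y))" for m
  define s where "s ms x = (if ms = [] then f x else
      SOME y. y \<in> points B \<and> partial_iso A B [first (hd ms), (x, y)])" for ms x
  define t where "t ms y = (if ms = [] then g y else
      SOME x. x \<in> points A \<and> partial_iso A B [first (hd ms), (x, y)])" for ms y
  have "set ps \<subseteq> points A \<times> points B \<and> partial_iso A B ps"
    if play: "play A B (s, t) ms ps" and len: "length ms = 2" for ms ps
  proof -
    obtain m p where mp: "play A B (s, t) [m] [p]"
      and ps: "(\<exists>x \<in> points A. ps = [p, (x, s [m] x)]) \<or> (\<exists>y \<in> points B. ps = [p, (t [m] y, y)])"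
      using play_length_2_cases[OF play len] by (metis fst_conv snd_conv)
    obtain u v where p: "p = (u, v)" "first m = p" "u \<in> points A" "v \<in> points B"
      and uv: "colour_profile A u = colour_profile B v"
      using play_length_1_cases[OF mp] f g by (auto simp: s_def t_def first_def)
    have "s [m] x \<in> points B \<and> partial_iso A B [p, (x, s [m] x)]" if "x \<in> points A" for x
      using someI_ex[OF second_answer_exists[OF A B p(3,4) that uv, unfolded Bex_def]]
      by (simp add: s_def p)
    moreover have "t [m] y \<in> points A \<and> partial_iso A B [p, (t [m] y, y)]" if "y \<in> points B" for y
      using someI_ex[OF second_answer_exists[OF B A p(4,3) that uv[symmetric],
          unfolded Bex_def partial_iso_pair_swap[of B A]]]
      by (simp add: t_def p)
    ultimately show ?thesis using ps p by auto
  qed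
  then have "winning_strategy 2 A B (s, t)"
    unfolding winning_strategy_def by blast
  then show ?thesis by (auto simp: ef_equiv_def)
qed

section \<open>Deleting a repeated point\<close>

text \<open>
  A point between two others of its colour can be deleted without changing what any other point
  sees: transitivity puts one of the two on the side on which \<open>b\<close> was seen.
\<close>

lemma colour_profile_delete:
  assumes A: "coloured_linear_order A" and x: "x \<in> points A" "x \<noteq> b"
    and d: "d \<in> points A" "(d, b) \<in> less_rel A" "colour A d = colour A b"
    and e: "e \<in> points A" "(b, e) \<in> less_rel A" "colour A e = colour A b"
  shows "colour_profile (induced A (- {b})) x = colour_profile A x"
proof -
  have tr: "trans (less_rel A)" and irr: "(u, u) \<notin> less_rel A" for u
    using A unfolding coloured_linear_order_def strict_linear_order_on_def irrefl_on_def by blast+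
  have "d \<noteq> b" "e \<noteq> b" using irr d e by auto
  have "\<exists>z \<in> points A. z \<noteq> b \<and> (z, x) \<in> less_rel A \<and> colour A z = colour A y"
    if "y \<in> points A" "(y, x) \<in> less_rel A" for y
    using that d \<open>d \<noteq> b\<close> by (cases "y = b") (auto dest: transD[OF tr])
  moreover have "\<exists>z \<in> points A. z \<noteq> b \<and> (x, z) \<in> less_rel A \<and> colour A z = colour A y"
    if "y \<in> points A" "(x, y) \<in> less_rel A" for y
    using that e \<open>e \<noteq> b\<close> by (cases "y = b") (auto dest: transD[OF tr])
  ultimately show ?thesis
    using x unfolding colour_profile_def induced_def
    by (auto simp: image_iff) metis+
qed

lemma equal_profile_not_optimal:
  assumes A: "coloured_linear_order A" "finite (points A)"
    and ab: "a \<in> points A" "b \<in> points A" "(a, b) \<in> less_rel A"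
    and eq: "colour_profile A a = colour_profile A b"
  shows "\<not> optimal 2 A"
proof -
  let ?B = "induced A (- {b})"
  have pts: "points ?B = points A - {b}" by (auto simp: induced_def)
  have "a \<noteq> b"
    using A ab unfolding coloured_linear_order_def strict_linear_order_on_def irrefl_on_def by blast
  have c: "colour A a = colour A b" using eq by (simp add: colour_profile_def)
  have "colour A b \<in> colour A ` {y \<in> points A. (a, y) \<in> less_rel A}"
    using ab by auto
  then obtain e where e: "e \<in> points A" "(b, e) \<in> less_rel A" "colour A e = colour A b"
    using eq by (auto simp: colour_profile_def)
  have same: "colour_profile ?B x = colour_profile A x" if "x \<in> points A" "x \<noteq> b" for x
    using colour_profile_delete[OF A(1) that ab(1,3) c e] .
  have "colour_profile A ` points A = colour_profile A ` (points A - {b})"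
  proof -
    have "points A = insert b (points A - {b})" using ab by blast
    moreover have "colour_profile A b \<in> colour_profile A ` (points A - {b})"
      unfolding eq[symmetric] using ab \<open>a \<noteq> b\<close> by blast
    ultimately show ?thesis by (metis image_insert insert_absorb)
  qed
  also have "\<dots> = colour_profile ?B ` points ?B"
    unfolding pts by (rule image_cong) (auto simp: same)
  finally have "ef_equiv 2 A ?B"
    by (intro ef_equiv_2I A coloured_linear_order_induced)
  moreover have "card (points ?B) < card (points A)"
    unfolding pts using A ab by (intro card_Diff1_less)
  moreover have "finite (points ?B)" using A by (simp add: pts)
  ultimately show ?thesis
    using coloured_linear_order_induced[OF A(1)] unfolding optimal_def by blast
qed

theorem theorem2p5:
  fixes m :: nat and A :: "('a, 'c) col_order"
  assumes "m_coloured_linear_order m A"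
    and "finite (points A)"
    and "optimal 2 A"
  shows "\<forall>a \<in> points A. \<forall>b \<in> points A. a \<noteq> b \<longrightarrow> character 1 A a \<noteq> character 1 A b"
proof (intro ballI impI notI)
  fix a b
  assume ab: "a \<in> points A" "b \<in> points A" "a \<noteq> b" and eq: "character 1 A a = character 1 A b"
  have A: "coloured_linear_order A"
    using assms(3) by (simp add: optimal_def)
  have p: "colour_profile A a = colour_profile A b"
    using character_1_eq_imp_colour_profile_eq[OF A eq] .
  have "(a, b) \<in> less_rel A \<or> (b, a) \<in> less_rel A"
    using A ab unfolding coloured_linear_order_def strict_linear_order_on_def total_on_def by blast
  then show False
    using equal_profile_not_optimal[OF A assms(2) ab(1,2) _ p]
      equal_profile_not_optimal[OF A assms(2) ab(2,1) _ p[symmetric]] assms(3)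
    by blast
qed

end
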